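(* Let $A$ be an algebraic CPO with basis $B$, $C$ a CPO, and $f:B\to C$ monotone. Then $\overline f:A\to C$ is continuous.
   Context: An ordered type is a type with a reflexive transitive relation $\sqsubseteq$. $U:\mathbb{N}\to X$ is directed if $\forall i\,j\,\exists k,\ U\,i\sqsubseteq U\,k\land U\,j\sqsubseteq U\,k$; an $\omega$-chain if $i\le j\Rightarrow U\,i\sqsubseteq U\,j$. A CPO (dCPO) is an ordered type in which every directed $U:\mathbb{N}\to X$ has a supremum; an $\omega$-CPO one in which every $\omega$-chain has a supremum. $h:X\to Y$ is monotone if $x\sqsubseteq y\Rightarrow h\,x\sqsubseteq h\,y$, and continuous if $h(\sup U)=\sup(h\circ U)$ for every directed $U$. $x$ is compact if for every directed $U$ with $\sup U=x$ there is $i$ with $U\,i=x$; a type is compact if all its elements are. For an $\omega$-CPO $A$ and ordered type $B$, $B$ is dense in $A$ if there are continuous $\mathsf{incl}:B\to A$ and $\mathsf{idl}:A\to\mathbb{N}\to B$ with $\mathsf{idl}\,a$ an $\omega$-chain and $\sup(\mathsf{incl}\circ\mathsf{idl}\,a)=a$ for all $a$. $A$ is an algebraic CPO with basis $B$ if $B$ is compact and dense in $A$. For monotone $f:B\to C$, $\overline f(a):=\sup_i f(\mathsf{idl}\,a\,i)$ (supremum chosen by choice). *)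

theory Defs
  imports Main
begin

text \<open>
  Ordered types carry a mere preorder, so suprema are unique only up to order-equivalence.
  Accordingly ``\<open>sup U = s\<close>'' is rendered by the relation \<open>is_sup U s\<close>.
\<close>

context preorder
begin

definition directed :: "(nat \<Rightarrow> 'a) \<Rightarrow> bool" where
  "directed U \<longleftrightarrow> (\<forall>i j. \<exists>k. U i \<le> U k \<and> U j \<le> U k)"

definition omega_chain :: "(nat \<Rightarrow> 'a) \<Rightarrow> bool" where
  "omega_chain U \<longleftrightarrow> (\<forall>i j. i \<le> j \<longrightarrow> U i \<le> U j)"

definition is_sup :: "(nat \<Rightarrow> 'a) \<Rightarrow> 'a \<Rightarrow> bool" where
  "is_sup U s \<longleftrightarrow> (\<forall>i. U i \<le> s) \<and> (\<forall>u. (\<forall>i. U i \<le> u) \<longrightarrow> s \<le> u)"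

definition order_equiv :: "'a \<Rightarrow> 'a \<Rightarrow> bool" where
  "order_equiv x y \<longleftrightarrow> x \<le> y \<and> y \<le> x"

text \<open>
  The sequence attains its supremum up to order-equivalence. Literal equality \<open>U i = x\<close> is a
  stronger demand: applied to constant sequences it would force a type all of whose elements are
  compact to be antisymmetric. For partial orders the two coincide.
\<close>

definition compact_elem :: "'a \<Rightarrow> bool" where
  "compact_elem x \<longleftrightarrow> (\<forall>U. directed U \<and> is_sup U x \<longrightarrow> (\<exists>i. order_equiv (U i) x))"

end

class dcpo = preorder +
  assumes directed_has_sup: "directed U \<Longrightarrow> \<exists>s. is_sup U s"

class omega_cpo = preorder +
  assumes omega_chain_has_sup: "omega_chain U \<Longrightarrow> \<exists>s. is_sup U s"

text \<open>
  The domain need not be complete: the condition concerns every directed sequence that has a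
  supremum.
\<close>

definition continuous :: "('a::preorder \<Rightarrow> 'b::preorder) \<Rightarrow> bool" where
  "continuous h \<longleftrightarrow> (\<forall>U s. directed U \<and> is_sup U s \<longrightarrow> is_sup (h \<circ> U) (h s))"

definition compact_type :: "'b::preorder itself \<Rightarrow> bool" where
  "compact_type _ \<longleftrightarrow> (\<forall>x::'b. compact_elem x)"

text \<open>Continuity of \<open>idl\<close> refers to the pointwise order on \<open>nat \<Rightarrow> 'b\<close>.\<close>

definition dense_via :: "('b::preorder \<Rightarrow> 'a::omega_cpo) \<Rightarrow> ('a \<Rightarrow> nat \<Rightarrow> 'b) \<Rightarrow> bool" where
  "dense_via incl idl \<longleftrightarrow>
     continuous incl \<and> continuous idl \<and>
     (\<forall>a. omega_chain (idl a)) \<and> (\<forall>a. is_sup (incl \<circ> idl a) a)"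

text \<open>
  The witnesses \<open>incl\<close> and \<open>idl\<close> of density are explicit parameters, because the extension of a
  monotone map is defined in terms of \<open>idl\<close>.
\<close>

definition algebraic_cpo :: "('b::preorder \<Rightarrow> 'a::omega_cpo) \<Rightarrow> ('a \<Rightarrow> nat \<Rightarrow> 'b) \<Rightarrow> bool" where
  "algebraic_cpo incl idl \<longleftrightarrow> compact_type TYPE('b) \<and> dense_via incl idl"

definition extension ::
  "('a \<Rightarrow> nat \<Rightarrow> 'b) \<Rightarrow> ('b \<Rightarrow> 'c::preorder) \<Rightarrow> 'a \<Rightarrow> 'c" where
  "extension idl f a = (SOME c. is_sup (\<lambda>i. f (idl a i)) c)"

end

theory Submission
  imports Defs
begin

text \<open>
  Each coordinate \<open>a \<mapsto> idl a i\<close> is continuous, so for directed \<open>U\<close> the compact element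
  \<open>idl (sup U) i\<close> is the supremum of \<open>n \<mapsto> idl (U n) i\<close> and hence lies below some
  \<open>idl (U n) i\<close>. Consequently \<open>f (idl (sup U) i)\<close> lies below the value of the extension at \<open>U n\<close>,
  and therefore below every upper bound of these values.
\<close>

context preorder
begin

lemma is_supI:
  assumes "\<And>i. U i \<le> s" and "\<And>u. (\<And>i. U i \<le> u) \<Longrightarrow> s \<le> u"
  shows "is_sup U s"
  using assms by (simp add: is_sup_def)

lemma is_sup_upper: "is_sup U s \<Longrightarrow> U i \<le> s"
  by (simp add: is_sup_def)

lemma is_sup_least: "is_sup U s \<Longrightarrow> (\<And>i. U i \<le> u) \<Longrightarrow> s \<le> u"
  by (simp add: is_sup_def)

lemma directed_if_greatest: "(\<And>i. U i \<le> U k) \<Longrightarrow> directed U"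
  unfolding directed_def by blast

lemma is_sup_if_greatest: "(\<And>i. U i \<le> U k) \<Longrightarrow> is_sup U (U k)"
  by (rule is_supI)

lemma omega_chain_imp_directed: "omega_chain U \<Longrightarrow> directed U"
  unfolding omega_chain_def directed_def by (metis max.cobounded1 max.cobounded2)

lemma compact_elem_le_directed:
  assumes "compact_elem x" and "directed U" and "is_sup U x"
  obtains i where "x \<le> U i"
  using assms unfolding compact_elem_def order_equiv_def by blast

end

lemma directed_comp_monotone:
  fixes h :: "'a::preorder \<Rightarrow> 'b::preorder"
  assumes "directed U" and "monotone (\<le>) (\<le>) h"
  shows "directed (h \<circ> U)"
  using assms unfolding directed_def monotone_def comp_def by blast

lemma is_sup_apply:
  fixes V :: "nat \<Rightarrow> 'i \<Rightarrow> 'b::preorder"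
  assumes "is_sup V v"
  shows "is_sup (\<lambda>n. V n i) (v i)"
proof (rule is_supI)
  show "V n i \<le> v i" for n
    using is_sup_upper[OF assms] by (rule le_funD)
next
  fix u assume "\<And>n. V n i \<le> u"
  then have "V n \<le> v(i := u)" for n
    using is_sup_upper[OF assms, of n] by (simp add: le_fun_def)
  then have "v \<le> v(i := u)"
    by (rule is_sup_least[OF assms])
  from le_funD[OF this, of i] show "v i \<le> u"
    by simp
qed

lemma continuousD: "continuous h \<Longrightarrow> directed U \<Longrightarrow> is_sup U s \<Longrightarrow> is_sup (h \<circ> U) (h s)"
  unfolding continuous_def by blast

lemma continuous_imp_monotone:
  assumes "continuous h"
  shows "monotone (\<le>) (\<le>) h"
proof (rule monotoneI)
  fix x y :: 'a assume "x \<le> y"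
  define U where "U n = (if n = 0 then x else y)" for n :: nat
  have greatest: "U n \<le> U 1" for n
    using \<open>x \<le> y\<close> by (simp add: U_def)
  have "is_sup (h \<circ> U) (h (U 1))"
    using assms directed_if_greatest[of U, OF greatest] is_sup_if_greatest[of U, OF greatest]
    by (rule continuousD)
  from is_sup_upper[OF this, of 0] show "h x \<le> h y"
    by (simp add: U_def)
qed

lemma continuous_monotoneI:
  fixes h :: "'a::preorder \<Rightarrow> 'b::preorder"
  assumes "monotone (\<le>) (\<le>) h"
    and "\<And>U s u. directed U \<Longrightarrow> is_sup U s \<Longrightarrow> (\<And>n. h (U n) \<le> u) \<Longrightarrow> h s \<le> u"
  shows "continuous h"
  unfolding continuous_def
proof (intro allI impI, elim conjE)
  fix U :: "nat \<Rightarrow> 'a" and s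
  assume U: "directed U" "is_sup U s"
  show "is_sup (h \<circ> U) (h s)"
  proof (rule is_supI)
    show "(h \<circ> U) n \<le> h s" for n
      using monotoneD[OF assms(1) is_sup_upper[OF U(2)]] by simp
    show "h s \<le> u" if "\<And>n. (h \<circ> U) n \<le> u" for u
      using assms(2)[OF U] that by simp
  qed
qed

lemma continuous_apply:
  fixes h :: "'a::preorder \<Rightarrow> 'i \<Rightarrow> 'b::preorder"
  assumes "continuous h"
  shows "continuous (\<lambda>x. h x i)"
  using is_sup_apply[OF continuousD[OF assms]] by (simp add: continuous_def comp_def)

lemma continuous_compact_elem_le:
  assumes "continuous h" and "compact_elem (h s)" and "directed U" and "is_sup U s"
  obtains n where "h s \<le> h (U n)"
proof -
  have "directed (h \<circ> U)"
    using assms(3) continuous_imp_monotone[OF assms(1)] by (rule directed_comp_monotone)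
  moreover have "is_sup (h \<circ> U) (h s)"
    using assms(1,3,4) by (rule continuousD)
  ultimately obtain n where "h s \<le> (h \<circ> U) n"
    by (rule compact_elem_le_directed[OF assms(2)])
  then show thesis
    using that by simp
qed

lemma is_sup_extension:
  fixes f :: "'b::preorder \<Rightarrow> 'c::dcpo"
  assumes "directed (idl a)" and "monotone (\<le>) (\<le>) f"
  shows "is_sup (\<lambda>i. f (idl a i)) (extension idl f a)"
  using directed_has_sup[OF directed_comp_monotone[OF assms]]
  unfolding extension_def comp_def by (rule someI_ex)

lemma monotone_extension:
  fixes idl :: "'a::preorder \<Rightarrow> nat \<Rightarrow> 'b::preorder" and f :: "'b \<Rightarrow> 'c::dcpo"
  assumes "\<And>a. directed (idl a)"
    and "monotone (\<le>) (\<le>) idl"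
    and "monotone (\<le>) (\<le>) f"
  shows "monotone (\<le>) (\<le>) (extension idl f)"
proof (rule monotoneI)
  fix x y :: 'a assume "x \<le> y"
  note is_sup_ext = is_sup_extension[of idl, OF assms(1,3)]
  show "extension idl f x \<le> extension idl f y"
  proof (rule is_sup_least[OF is_sup_ext])
    fix i
    have "idl x i \<le> idl y i"
      using monotoneD[OF assms(2) \<open>x \<le> y\<close>] by (rule le_funD)
    then have "f (idl x i) \<le> f (idl y i)"
      by (rule monotoneD[OF assms(3)])
    also have "\<dots> \<le> extension idl f y"
      by (rule is_sup_upper[OF is_sup_ext])
    finally show "f (idl x i) \<le> extension idl f y" .
  qed
qed

lemma continuous_extension:
  fixes idl :: "'a::preorder \<Rightarrow> nat \<Rightarrow> 'b::preorder" and f :: "'b \<Rightarrow> 'c::dcpo"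
  assumes compact: "\<And>a i. compact_elem (idl a i)"
    and directed: "\<And>a. directed (idl a)"
    and cont: "continuous idl"
    and monotone: "monotone (\<le>) (\<le>) f"
  shows "continuous (extension idl f)"
proof (rule continuous_monotoneI)
  show "monotone (\<le>) (\<le>) (extension idl f)"
    using directed continuous_imp_monotone[OF cont] monotone by (rule monotone_extension)
next
  fix U s u
  assume U: "directed U" "is_sup U s" and upper: "\<And>n. extension idl f (U n) \<le> u"
  note is_sup_ext = is_sup_extension[of idl, OF directed monotone]
  show "extension idl f s \<le> u"
  proof (rule is_sup_least[OF is_sup_ext])
    fix i
    obtain n where "idl s i \<le> idl (U n) i"
      using continuous_apply[OF cont] compact U by (rule continuous_compact_elem_le)
    then have "f (idl s i) \<le> f (idl (U n) i)"
      by (rule monotoneD[OF monotone])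
    also have "\<dots> \<le> extension idl f (U n)"
      by (rule is_sup_upper[OF is_sup_ext])
    also have "\<dots> \<le> u"
      by (rule upper)
    finally show "f (idl s i) \<le> u" .
  qed
qed

theorem mainTheorem13:
  fixes incl :: "'b::preorder \<Rightarrow> 'a::omega_cpo"
    and idl :: "'a \<Rightarrow> nat \<Rightarrow> 'b"
    and f :: "'b \<Rightarrow> 'c::dcpo"
  assumes "algebraic_cpo incl idl"
    and "monotone (\<le>) (\<le>) f"
  shows "continuous (extension idl f)"
proof (rule continuous_extension)
  have dense: "dense_via incl idl" and compact: "compact_type TYPE('b)"
    using assms(1) by (simp_all add: algebraic_cpo_def)
  show "compact_elem (idl a i)" for a i
    using compact by (simp add: compact_type_def)
  show "directed (idl a)" for a
    using dense by (simp add: dense_via_def omega_chain_imp_directed)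
  show "continuous idl"
    using dense by (simp add: dense_via_def)
  show "monotone (\<le>) (\<le>) f"
    by (rule assms(2))
qed

end
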